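(* Let $T$ be a unicellular forward weighted shift on $\mathcal H$, let $n\ge1$, and let $\mathcal M\subseteq\mathcal H$ be a closed subspace with $\dim\mathcal M=n$ that is invariant under both $T^{*2}$ and $T^{*3}$. Then there is a pair $(\alpha,\beta)\in\mathbb C^2$, $(\alpha,\beta)\neq(0,0)$, such that $$\mathcal M=\operatorname{span}\{e_0,e_1,\ldots,e_{n-2},\,\alpha e_{n-1}+\beta e_n\}.$$
   Context: $\mathbb N=\{0,1,2,\ldots\}$. $\mathcal H$ is a separable complex Hilbert space with orthonormal basis $\{e_n\}_{n\in\mathbb N}$. Given a bounded sequence $\{w_n\}_{n\in\mathbb N}$ of positive reals, the forward weighted shift is the bounded operator $T$ with $Te_n=w_ne_{n+1}$; its adjoint satisfies $T^*e_0=0$, $T^*e_n=w_{n-1}e_{n-1}$ for $n\ge1$. $T$ is unicellular if its closed invariant subspaces are totally ordered by inclusion. $T^{*r}$ denotes $(T^* )^r$. For $n=1$ the list $e_0,\ldots,e_{n-2}$ is empty. *)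

theory Defs
  imports "HOL-Analysis.Analysis"
begin

text \<open>
  Complex Hilbert spaces. The inner product \<open>cinner\<close> is linear in its first argument. The
  real inner product and the norm of the library are those of the underlying real Hilbert space:
  \<open>inner x y = Re (cinner x y)\<close>, whence \<open>norm x = sqrt (Re (cinner x x))\<close>.
\<close>

class complex_hilbert_space = real_inner + complete_space +
  fixes scaleC :: "complex \<Rightarrow> 'a \<Rightarrow> 'a"  (infixr "*\<^sub>C" 75)
    and cinner :: "'a \<Rightarrow> 'a \<Rightarrow> complex"
  assumes scaleC_add_right: "c *\<^sub>C (x + y) = c *\<^sub>C x + c *\<^sub>C y"
    and scaleC_add_left: "(c + d) *\<^sub>C x = c *\<^sub>C x + d *\<^sub>C x"
    and scaleC_scaleC: "c *\<^sub>C (d *\<^sub>C x) = (c * d) *\<^sub>C x"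
    and scaleR_scaleC: "r *\<^sub>R x = complex_of_real r *\<^sub>C x"
    and cinner_add_left: "cinner (x + y) z = cinner x z + cinner y z"
    and cinner_scaleC_left: "cinner (c *\<^sub>C x) y = c * cinner x y"
    and cinner_commute: "cinner x y = cnj (cinner y x)"
    and inner_eq_Re_cinner: "inner x y = Re (cinner x y)"

lemma scaleC_one: "1 *\<^sub>C x = (x :: 'a :: complex_hilbert_space)"
  using scaleR_scaleC[of 1 x] by simp

global_interpretation complex_vector:
  vector_space "scaleC :: complex \<Rightarrow> 'a \<Rightarrow> 'a :: complex_hilbert_space"
  defines csubspace = complex_vector.subspace
    and cspan = complex_vector.span
    and cdependent = complex_vector.dependent
    and crepresentation = complex_vector.representation
    and cextend_basis = complex_vector.extend_basis
    and cdim = complex_vector.dim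
  by unfold_locales (simp_all add: scaleC_add_right scaleC_add_left scaleC_scaleC scaleC_one)

definition bounded_clinear :: "('a :: complex_hilbert_space \<Rightarrow> 'a) \<Rightarrow> bool" where
  "bounded_clinear A \<longleftrightarrow> bounded_linear A \<and> (\<forall>c x. A (c *\<^sub>C x) = c *\<^sub>C A x)"

text \<open>
  The choice is unique whenever such a map exists, and for bounded \<open>A\<close> it exists by the
  Riesz representation theorem (compare the library's \<open>adjoint\<close> for real inner products).
\<close>

definition cadjoint :: "('a :: complex_hilbert_space \<Rightarrow> 'a) \<Rightarrow> 'a \<Rightarrow> 'a" where
  "cadjoint A = (SOME B. \<forall>x y. cinner (A x) y = cinner x (B y))"

definition orthonormal_basis :: "(nat \<Rightarrow> 'a :: complex_hilbert_space) \<Rightarrow> bool" where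
  "orthonormal_basis e \<longleftrightarrow>
     (\<forall>m n. cinner (e m) (e n) = (if m = n then 1 else 0)) \<and>
     closure (cspan (range e)) = UNIV"

definition forward_weighted_shift ::
    "(nat \<Rightarrow> 'a :: complex_hilbert_space) \<Rightarrow> (nat \<Rightarrow> real) \<Rightarrow> ('a \<Rightarrow> 'a) \<Rightarrow> bool" where
  "forward_weighted_shift e w T \<longleftrightarrow>
     (\<forall>n. w n > 0) \<and> bounded (range w) \<and>
     bounded_clinear T \<and> (\<forall>n. T (e n) = complex_of_real (w n) *\<^sub>C e (Suc n))"

definition closed_csubspace :: "'a :: complex_hilbert_space set \<Rightarrow> bool" where
  "closed_csubspace M \<longleftrightarrow> csubspace M \<and> closed M"

definition invariant_under :: "('a \<Rightarrow> 'a) \<Rightarrow> 'a set \<Rightarrow> bool" where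
  "invariant_under A M \<longleftrightarrow> A ` M \<subseteq> M"

definition unicellular :: "('a :: complex_hilbert_space \<Rightarrow> 'a) \<Rightarrow> bool" where
  "unicellular A \<longleftrightarrow>
     (\<forall>M N. closed_csubspace M \<and> invariant_under A M \<and>
            closed_csubspace N \<and> invariant_under A N \<longrightarrow> M \<subseteq> N \<or> N \<subseteq> M)"

end

theory Submission
  imports Defs "HOL-Computational_Algebra.Fundamental_Theorem_Algebra"
begin

text \<open>
  Write \<open>S = T\<^sup>*\<close>. Unicellularity leaves \<open>S\<close>, and hence \<open>S\<^sup>2\<close>, no nonzero eigenvalue. So \<open>S\<^sup>2\<close> is
  nilpotent on the finite-dimensional space \<open>M\<close>, and every vector of \<open>M\<close> has finitely many nonzero
  coordinates. Let \<open>d\<close> be the largest index of such a coordinate, attained by some \<open>f \<in> M\<close>. As \<open>S\<close>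
  lowers the top index by one, the vectors \<open>S\<^sup>k f \<in> M\<close> for \<open>2 \<le> k \<le> d\<close> give \<open>e 0, \<dots>, e (d - 2) \<in> M\<close>.
  Together with \<open>f\<close> these already span a space of dimension \<open>d\<close> (if \<open>d \<ge> 1\<close>), while \<open>M\<close> has dimension at
  most \<open>d + 1\<close>, so only two cases are left.
\<close>

section \<open>Complex inner products: algebra, Cauchy-Schwarz and continuity\<close>

lemma cinner_zero_left [simp]: "cinner 0 (y :: 'a :: complex_hilbert_space) = 0"
  using cinner_add_left[of 0 0 y] by simp

lemma cinner_zero_right [simp]: "cinner (y :: 'a :: complex_hilbert_space) 0 = 0"
  using cinner_commute[of y 0] by simp

lemma cinner_add_right: "cinner x (y + z :: 'a :: complex_hilbert_space) = cinner x y + cinner x z"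
  by (metis cinner_add_left cinner_commute complex_cnj_add)

lemma cinner_scaleC_right: "cinner x (c *\<^sub>C y :: 'a :: complex_hilbert_space) = cnj c * cinner x y"
  by (metis cinner_scaleC_left cinner_commute complex_cnj_mult)

lemma cinner_diff_left: "cinner (x - y) (z :: 'a :: complex_hilbert_space) = cinner x z - cinner y z"
  using cinner_add_left[of "x - y" y z] by simp

lemma cinner_diff_right: "cinner x (y - z :: 'a :: complex_hilbert_space) = cinner x y - cinner x z"
  using cinner_add_right[of x "y - z" z] by simp

lemma cinner_sum_left:
  "cinner (\<Sum>i\<in>I. f i) (z :: 'a :: complex_hilbert_space) = (\<Sum>i\<in>I. cinner (f i) z)"
  by (induction I rule: infinite_finite_induct) (auto simp: cinner_add_left)

lemma cinner_sum_right:
  "cinner z (\<Sum>i\<in>I. f i :: 'a :: complex_hilbert_space) = (\<Sum>i\<in>I. cinner z (f i))"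
  by (induction I rule: infinite_finite_induct) (auto simp: cinner_add_right)

lemma cinner_self: "cinner x x = complex_of_real ((norm (x :: 'a :: complex_hilbert_space))\<^sup>2)"
proof -
  have "Im (cinner x x) = 0"
    using arg_cong[OF cinner_commute[of x x], of Im] by simp
  moreover have "Re (cinner x x) = (norm x)\<^sup>2"
    by (simp add: inner_eq_Re_cinner[symmetric] power2_norm_eq_inner)
  ultimately show ?thesis
    by (simp add: complex_eq_iff)
qed

lemma cinner_self_eq_0_iff [simp]: "cinner x x = 0 \<longleftrightarrow> (x :: 'a :: complex_hilbert_space) = 0"
  by (simp add: cinner_self)

lemma norm_scaleC: "norm (c *\<^sub>C x :: 'a :: complex_hilbert_space) = cmod c * norm x"
proof -
  have "complex_of_real ((norm (c *\<^sub>C x))\<^sup>2) = (c * cnj c) * complex_of_real ((norm x)\<^sup>2)"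
    by (simp only: cinner_self[symmetric] cinner_scaleC_left cinner_scaleC_right mult_ac)
  also have "\<dots> = complex_of_real ((cmod c * norm x)\<^sup>2)"
    by (simp add: complex_norm_square[symmetric] power_mult_distrib)
  finally have "(norm (c *\<^sub>C x))\<^sup>2 = (cmod c * norm x)\<^sup>2"
    using of_real_eq_iff by blast
  then show ?thesis
    by (simp add: power2_eq_iff_nonneg)
qed

text \<open>The complex Cauchy-Schwarz inequality from the real one: scaling \<open>x\<close> by the
  conjugate of \<open>cinner x y\<close> makes the product real and nonnegative, so its real part
  loses nothing. One factor \<open>cmod (cinner x y)\<close> is then cancelled.\<close>

lemma norm_cinner_le: "cmod (cinner x y) \<le> norm x * norm (y :: 'a :: complex_hilbert_space)"
proof (cases "cinner x y = 0")
  case False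
  let ?c = "cnj (cinner x y)"
  have "(cmod (cinner x y))\<^sup>2 = inner (?c *\<^sub>C x) y"
    unfolding inner_eq_Re_cinner cinner_scaleC_left
    by (subst mult.commute) (simp add: complex_norm_square[symmetric] del: of_real_power flip: of_real_power)
  also have "\<dots> \<le> norm (?c *\<^sub>C x) * norm y"
    by (rule norm_cauchy_schwarz)
  also have "\<dots> = cmod (cinner x y) * (norm x * norm y)"
    by (simp add: norm_scaleC)
  finally show ?thesis
    using False by (simp add: power2_eq_square)
qed auto

lemma bounded_linear_cinner_left: "bounded_linear (\<lambda>x. cinner x (y :: 'a :: complex_hilbert_space))"
  by (rule bounded_linear_intro[of _ "norm y"])
     (simp_all add: cinner_add_left scaleR_scaleC cinner_scaleC_left norm_cinner_le
        scaleR_conv_of_real)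

lemma bounded_linear_cinner_right: "bounded_linear (\<lambda>y. cinner (x :: 'a :: complex_hilbert_space) y)"
  by (rule bounded_linear_intro[of _ "norm x"])
     (simp_all add: cinner_add_right scaleR_scaleC cinner_scaleC_right
        scaleR_conv_of_real mult.commute norm_cinner_le[of x, unfolded mult.commute[of "norm x"]])

lemma csubspace_scaleC_cancel:
  assumes "csubspace M" "c *\<^sub>C x \<in> M" "c \<noteq> 0"
  shows "x \<in> M"
  using complex_vector.subspace_scale[OF assms(1,2), of "inverse c"] assms(3)
  by (simp add: scaleC_scaleC scaleC_one)

lemma cinner_left_cong_imp_eq:
  fixes y z :: "'a :: complex_hilbert_space"
  assumes "\<And>x. cinner x y = cinner x z"
  shows "y = z"
proof -
  have "cinner (y - z) (y - z) = 0"
    using assms[of "y - z"] by (simp only: cinner_diff_right) simp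
  then show ?thesis
    by simp
qed

section \<open>Orthonormal bases, Riesz representation and the adjoint\<close>

lemma orthonormal_basisD:
  "orthonormal_basis e \<Longrightarrow> cinner (e m) (e n) = (if m = n then 1 else 0)"
  by (simp add: orthonormal_basis_def)

text \<open>The set of agreement is a closed subspace containing every \<open>e n\<close>, hence the
  closure of their span.\<close>

lemma orthonormal_basis_functional_eq:
  fixes e :: "nat \<Rightarrow> 'a :: complex_hilbert_space" and f g :: "'a \<Rightarrow> complex"
  assumes e: "orthonormal_basis e"
    and f: "bounded_linear f" "\<And>c x. f (c *\<^sub>C x) = c * f x"
    and g: "bounded_linear g" "\<And>c x. g (c *\<^sub>C x) = c * g x"
    and eq: "\<And>n. f (e n) = g (e n)"
  shows "f x = g x"
proof -
  let ?E = "{x. f x = g x}"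
  interpret f: bounded_linear f by (rule f)
  interpret g: bounded_linear g by (rule g)
  have "csubspace ?E"
    by (auto simp: complex_vector.subspace_def f.zero g.zero f.add g.add f(2) g(2))
  then have "cspan (range e) \<subseteq> ?E"
    using eq by (intro complex_vector.span_minimal) auto
  moreover have "closed ?E"
    by (intro closed_Collect_eq f.continuous_on g.continuous_on continuous_on_id)
  ultimately have "closure (cspan (range e)) \<subseteq> ?E"
    by (rule closure_minimal)
  then show ?thesis
    using e by (auto simp: orthonormal_basis_def)
qed

lemma orthonormal_basis_eqI:
  fixes e :: "nat \<Rightarrow> 'a :: complex_hilbert_space"
  assumes e: "orthonormal_basis e" and eq: "\<And>n. cinner y (e n) = cinner z (e n)"
  shows "y = z"
proof (rule cinner_left_cong_imp_eq)
  fix x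
  show "cinner x y = cinner x z"
  proof (rule orthonormal_basis_functional_eq[OF e, where f = "\<lambda>x. cinner x y"])
    show "cinner (e n) y = cinner (e n) z" for n
      using eq[of n] by (metis cinner_commute)
  qed (simp_all add: bounded_linear_cinner_left cinner_scaleC_left)
qed

lemma orthonormal_basis_finite_expansion:
  fixes e :: "nat \<Rightarrow> 'a :: complex_hilbert_space"
  assumes e: "orthonormal_basis e" and "\<And>m. m \<ge> k \<Longrightarrow> cinner f (e m) = 0"
  shows "f = (\<Sum>i<k. cinner f (e i) *\<^sub>C e i)"
proof (rule orthonormal_basis_eqI[OF e])
  fix m
  have "cinner (\<Sum>i<k. cinner f (e i) *\<^sub>C e i) (e m) = (\<Sum>i<k. if i = m then cinner f (e i) else 0)"
    unfolding cinner_sum_left cinner_scaleC_left orthonormal_basisD[OF e] by (intro sum.cong) auto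
  also have "\<dots> = cinner f (e m)"
    using assms(2)[of m] by (auto simp: not_less)
  finally show "cinner f (e m) = cinner (\<Sum>i<k. cinner f (e i) *\<^sub>C e i) (e m)" ..
qed

text \<open>Pythagoras; in the Riesz argument it controls partial sums and their
  differences.\<close>

lemma norm_square_orthonormal_sum:
  fixes e :: "nat \<Rightarrow> 'a :: complex_hilbert_space"
  assumes e: "orthonormal_basis e" and "finite I"
  shows "(norm (\<Sum>i\<in>I. c i *\<^sub>C e i))\<^sup>2 = (\<Sum>i\<in>I. (cmod (c i))\<^sup>2)"
proof -
  have "complex_of_real ((norm (\<Sum>i\<in>I. c i *\<^sub>C e i))\<^sup>2)
      = (\<Sum>i\<in>I. \<Sum>j\<in>I. if i = j then c i * cnj (c i) else 0)"
    unfolding cinner_self[symmetric] cinner_sum_left cinner_sum_right cinner_scaleC_left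
      cinner_scaleC_right orthonormal_basisD[OF e]
    by (subst sum.swap, intro sum.cong refl) (simp add: sum_distrib_left, intro sum.cong, auto)
  also have "\<dots> = complex_of_real (\<Sum>i\<in>I. (cmod (c i))\<^sup>2)"
    using \<open>finite I\<close> by (simp add: complex_norm_square[symmetric])
  finally show ?thesis
    using of_real_eq_iff by blast
qed

text \<open>
  Along an orthonormal basis the representing vector is the sum of the
  \<open>cnj (f (e n)) *\<^sub>C e n\<close>; testing \<open>f\<close> on the partial sums bounds their norms by that of \<open>f\<close>.
\<close>

lemma riesz_representation:
  fixes e :: "nat \<Rightarrow> 'a :: complex_hilbert_space" and f :: "'a \<Rightarrow> complex"
  assumes e: "orthonormal_basis e"
    and f: "bounded_linear f" "\<And>c x. f (c *\<^sub>C x) = c * f x"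
  shows "\<exists>z. \<forall>x. f x = cinner x z"
proof -
  interpret f: bounded_linear f by (rule f)
  \<comment> \<open>The conjugate compensates for \<open>cinner\<close> being conjugate-linear in
    its second argument.\<close>
  define a where "a n = cnj (f (e n))" for n
  define s where "s N = (\<Sum>i<N. a i *\<^sub>C e i)" for N
  define q where "q N = (\<Sum>i<N. (cmod (a i))\<^sup>2)" for N
  obtain K where K: "0 \<le> K" "\<And>x. cmod (f x) \<le> norm x * K"
    using f.nonneg_bounded by blast
  have norm_s: "(norm (s N))\<^sup>2 = q N" for N
    unfolding s_def q_def by (rule norm_square_orthonormal_sum[OF e]) simp
  have f_s: "f (s N) = complex_of_real (q N)" for N
    unfolding s_def q_def f.sum f(2) a_def of_real_sum complex_norm_square by simp
  have q_nonneg: "0 \<le> q N" for N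
    by (simp add: q_def sum_nonneg)
  have s_le: "norm (s N) \<le> K" for N
  proof -
    \<comment> \<open>\<open>f (s N)\<close> is real and equals the square of
      \<open>norm (s N)\<close>, so the bound on \<open>f\<close> leaves one factor
      \<open>norm (s N)\<close> to cancel.\<close>
    have le: "norm (s N) * norm (s N) \<le> norm (s N) * K"
      using K(2)[of "s N"] q_nonneg[of N]
      by (simp only: f_s norm_of_real norm_s[symmetric] power2_eq_square abs_mult_self_eq)
    show ?thesis
    proof (cases "norm (s N) = 0")
      case False
      then have "0 < norm (s N)"
        by simp
      with le show ?thesis
        by (rule mult_left_le_imp_le)
    qed (simp add: \<open>0 \<le> K\<close>)
  qed
  have "q N \<le> K\<^sup>2" for N
    using s_le[of N] by (simp add: norm_s[symmetric] power_mono)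
  moreover have "incseq q"
    by (intro incseq_SucI) (simp add: q_def)
  ultimately have "convergent q"
    by (intro Bseq_mono_convergent BseqI'[of _ "K\<^sup>2"])
       (auto simp: q_nonneg incseq_def)
  then have "Cauchy q"
    by (rule convergent_Cauchy)
  \<comment> \<open>By orthogonality, distances between partial sums are read off from
    \<open>q\<close>, so the Cauchy property passes from the real sequence \<open>q\<close> to
    \<open>s\<close>.\<close>
  have diff_s: "(norm (s n - s m))\<^sup>2 = q n - q m" if "m \<le> n" for m n
  proof -
    have split: "{..<n} - {..<m} = {m..<n}"
      by auto
    have "s n - s m = (\<Sum>i\<in>{m..<n}. a i *\<^sub>C e i)"
      using that by (simp add: s_def sum_diff[symmetric] split)
    moreover have "q n - q m = (\<Sum>i\<in>{m..<n}. (cmod (a i))\<^sup>2)"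
      using that by (simp add: q_def sum_diff[symmetric] split)
    ultimately show ?thesis
      by (simp add: norm_square_orthonormal_sum[OF e])
  qed
  have "Cauchy s"
  proof (rule metric_CauchyI)
    fix r :: real assume "r > 0"
    then obtain M where M: "\<And>m n. m \<ge> M \<Longrightarrow> n \<ge> M \<Longrightarrow> dist (q m) (q n) < r\<^sup>2"
      using metric_CauchyD[OF \<open>Cauchy q\<close>, of "r\<^sup>2"] by auto
    have "dist (s m) (s n) < r" if "m \<ge> M" "n \<ge> M" for m n
    proof -
      have "(norm (s m - s n))\<^sup>2 = \<bar>q m - q n\<bar>"
      proof (cases "m \<le> n")
        case True
        then show ?thesis
          using diff_s[of m n] zero_le_power2[of "norm (s n - s m)"] by (simp add: norm_minus_commute)
      next
        case False
        then show ?thesis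
          using diff_s[of n m] zero_le_power2[of "norm (s m - s n)"] by simp
      qed
      also have "\<dots> < r\<^sup>2"
        using M[OF that] by (simp add: dist_real_def)
      finally show ?thesis
        using \<open>r > 0\<close> by (simp add: dist_norm power_less_imp_less_base)
    qed
    then show "\<exists>M. \<forall>m\<ge>M. \<forall>n\<ge>M. dist (s m) (s n) < r"
      by blast
  qed
  then obtain z where z: "s \<longlonglongrightarrow> z"
    using Cauchy_convergent convergent_def by blast
  have "f (e n) = cinner (e n) z" for n
  proof (rule LIMSEQ_unique)
    show "(\<lambda>N. cinner (e n) (s N)) \<longlonglongrightarrow> cinner (e n) z"
      by (rule bounded_linear.tendsto[OF bounded_linear_cinner_right z])
    have "cinner (e n) (s N) = f (e n)" if "N > n" for N
    proof -
      have "cinner (e n) (s N) = (\<Sum>i<N. if n = i then f (e i) else 0)"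
        unfolding s_def cinner_sum_right cinner_scaleC_right orthonormal_basisD[OF e] a_def
        by (intro sum.cong) auto
      then show ?thesis
        using that by simp
    qed
    then show "(\<lambda>N. cinner (e n) (s N)) \<longlonglongrightarrow> f (e n)"
      by (intro tendsto_eventually) (auto simp: eventually_sequentially intro: exI[of _ "Suc n"])
  qed
  then have "f x = cinner x z" for x
    using orthonormal_basis_functional_eq[OF e f bounded_linear_cinner_left cinner_scaleC_left]
    by blast
  then show ?thesis
    by blast
qed

text \<open>As \<open>cadjoint\<close> is a choice, its defining property rests on existence, which
  Riesz representation of \<open>\<lambda>x. cinner (T x) y\<close> provides for each
  \<open>y\<close>.\<close>

lemma cinner_cadjoint:
  fixes e :: "nat \<Rightarrow> 'a :: complex_hilbert_space" and T :: "'a \<Rightarrow> 'a"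
  assumes e: "orthonormal_basis e" and T: "bounded_clinear T"
  shows "cinner (T x) y = cinner x (cadjoint T y)"
proof -
  have "\<exists>z. \<forall>x. cinner (T x) y = cinner x z" for y
  proof -
    have "bounded_linear (\<lambda>x. cinner (T x) y)"
      using T by (intro bounded_linear_compose[OF bounded_linear_cinner_left])
        (simp add: bounded_clinear_def)
    moreover have "cinner (T (c *\<^sub>C x)) y = c * cinner (T x) y" for c x
      using T by (simp add: bounded_clinear_def cinner_scaleC_left)
    ultimately show ?thesis
      by (rule riesz_representation[OF e])
  qed
  then have "\<exists>B. \<forall>x y. cinner (T x) y = cinner x (B y)"
    by metis
  then show ?thesis
    unfolding cadjoint_def by (rule someI2_ex) blast
qed

section \<open>Operators without nonzero eigenvalues on finite-dimensional spaces\<close>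

text \<open>
  Splitting off one linear factor of \<open>p\<close> at a time: the factors with nonzero root are injective
  and may be cancelled, so only powers of \<open>R\<close> remain.
\<close>

lemma polynomial_relation_imp_nilpotent:
  fixes R :: "'a :: complex_hilbert_space \<Rightarrow> 'a"
  assumes add: "\<And>x y. R (x + y) = R x + R y"
    and scale: "\<And>c x. R (c *\<^sub>C x) = c *\<^sub>C R x"
    and no_eigenvalue: "\<And>c x. c \<noteq> 0 \<Longrightarrow> R x = c *\<^sub>C x \<Longrightarrow> x = 0"
  shows "p \<noteq> 0 \<Longrightarrow> degree p \<le> N \<Longrightarrow> (\<Sum>i\<le>N. coeff p i *\<^sub>C (R ^^ i) x) = 0 \<Longrightarrow> (R ^^ N) x = 0"
proof (induction N arbitrary: p x)
  case 0
  then have "coeff p 0 \<noteq> 0"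
    using leading_coeff_0_iff[of p] by simp
  with 0 show ?case
    by (simp add: complex_vector.scale_eq_0_iff)
next
  case (Suc N)
  have zero: "R 0 = 0"
    using scale[of 0 0] by simp
  have diff: "R (x - y) = R x - R y" for x y
    using add[of "x - y" y] by simp
  have pow_diff: "(R ^^ i) (x - y) = (R ^^ i) x - (R ^^ i) y" for i x y
    by (induction i) (simp_all add: diff)
  have pow_scale: "(R ^^ i) (c *\<^sub>C x) = c *\<^sub>C (R ^^ i) x" for i c x
    by (induction i) (simp_all add: scale)
  show ?case
  proof (cases "degree p = 0")
    case True
    have "(\<Sum>i\<le>Suc N. coeff p i *\<^sub>C (R ^^ i) x) = coeff p 0 *\<^sub>C x"
      using True by (subst sum.remove[of _ 0]) (auto intro!: sum.neutral simp: coeff_eq_0)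
    moreover have "coeff p 0 \<noteq> 0"
      using True Suc.prems(1) leading_coeff_0_iff[of p] by simp
    ultimately have "x = 0"
      using Suc.prems(3) by (simp add: complex_vector.scale_eq_0_iff)
    moreover have "(R ^^ i) 0 = 0" for i
      by (induction i) (simp_all add: zero)
    ultimately show ?thesis
      by blast
  next
    case False
    then obtain c where "poly p c = 0"
      using fundamental_theorem_of_algebra[of p] by (auto simp: constant_degree)
    then obtain q where p: "p = [:- c, 1:] * q"
      using poly_eq_0_iff_dvd by blast
    have "q \<noteq> 0"
      using Suc.prems(1) p by auto
    then have deg: "degree q \<le> N"
      using Suc.prems(2) unfolding p by (subst (asm) degree_mult_eq) auto
    \<comment> \<open>With \<open>p = (X - c) q\<close>, applying \<open>p(R)\<close> to
      \<open>x\<close> is applying \<open>q(R)\<close> to \<open>?y\<close>, which feeds the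
      induction hypothesis.\<close>
    let ?y = "R x - c *\<^sub>C x"
    have coeff_p: "coeff p i = (case i of 0 \<Rightarrow> 0 | Suc j \<Rightarrow> coeff q j) - c * coeff q i" for i
      by (simp add: p coeff_pCons split: nat.split)
    have "(\<Sum>i\<le>Suc N. coeff p i *\<^sub>C (R ^^ i) x)
        = (\<Sum>i\<le>Suc N. (case i of 0 \<Rightarrow> 0 | Suc j \<Rightarrow> coeff q j) *\<^sub>C (R ^^ i) x)
          - (\<Sum>i\<le>Suc N. (c * coeff q i) *\<^sub>C (R ^^ i) x)"
      by (simp only: coeff_p complex_vector.scale_left_diff_distrib sum_subtractf)
    also have "(\<Sum>i\<le>Suc N. (case i of 0 \<Rightarrow> 0 | Suc j \<Rightarrow> coeff q j) *\<^sub>C (R ^^ i) x)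
        = (\<Sum>i\<le>N. coeff q i *\<^sub>C (R ^^ i) (R x))"
      by (subst sum.atMost_Suc_shift) (simp add: funpow_swap1)
    also have "(\<Sum>i\<le>Suc N. (c * coeff q i) *\<^sub>C (R ^^ i) x)
        = (\<Sum>i\<le>N. coeff q i *\<^sub>C (R ^^ i) (c *\<^sub>C x))"
      using deg by (simp add: coeff_eq_0 pow_scale scaleC_scaleC mult.commute)
    finally have "(\<Sum>i\<le>N. coeff q i *\<^sub>C (R ^^ i) ?y) = 0"
      using Suc.prems(3)
      by (simp add: pow_diff complex_vector.scale_right_diff_distrib sum_subtractf)
    then have "(R ^^ N) ?y = 0"
      using Suc.IH[OF \<open>q \<noteq> 0\<close> deg] by blast
    then have eig: "R ((R ^^ N) x) = c *\<^sub>C (R ^^ N) x"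
      by (simp add: pow_diff pow_scale funpow_swap1)
    \<comment> \<open>For \<open>c = 0\<close> the equation \<open>eig\<close> is the claim itself;
      otherwise it forces \<open>(R ^^ N) x = 0\<close>.\<close>
    then show ?thesis
      using no_eigenvalue[OF _ eig] by (cases "c = 0") (auto simp: zero)
  qed
qed

text \<open>Dependence is a notion for sets, so a family with a repetition gets the explicit
  relation \<open>x i - x j = 0\<close>. Without repetition, \<open>n + 1\<close> vectors outnumber
  a basis.\<close>

lemma finite_dim_linear_relation:
  fixes x :: "nat \<Rightarrow> 'a :: complex_hilbert_space"
  assumes "cdim M = n" "n > 0" "\<And>i. i \<le> n \<Longrightarrow> x i \<in> M"
  obtains c where "\<exists>i\<le>n. c i \<noteq> 0" "(\<Sum>i\<le>n. c i *\<^sub>C x i) = 0"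
proof (cases "inj_on x {..n}")
  case True
  obtain B where B: "M \<subseteq> cspan B" "card B = n"
    using complex_vector.basis_exists[of M] assms(1) by metis
  \<comment> \<open>Infinite sets have \<open>card\<close> 0, so only a positive \<open>n\<close>
    certifies a finite basis.\<close>
  have "finite B"
    using B(2) \<open>n > 0\<close> by (simp add: card_ge_0_finite)
  have "cdependent (x ` {..n})"
  proof (rule ccontr)
    assume "\<not> cdependent (x ` {..n})"
    then have "card (x ` {..n}) \<le> card B"
      using complex_vector.independent_span_bound[OF \<open>finite B\<close>] B(1) assms(3)
      by (metis (no_types, lifting) atMost_iff image_subsetI subsetD)
    then show False
      using True B(2) by (simp add: card_image)
  qed
  then obtain u where "\<exists>v\<in>x ` {..n}. u v \<noteq> 0" "(\<Sum>v\<in>x ` {..n}. u v *\<^sub>C v) = 0"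
    using complex_vector.dependent_finite[of "x ` {..n}"] by auto
  then show ?thesis
    using True by (intro that[of "u \<circ> x"]) (auto simp: sum.reindex)
next
  case False
  then obtain i j where ij: "i \<le> n" "j \<le> n" "i \<noteq> j" "x i = x j"
    by (auto simp: inj_on_def)
  let ?c = "\<lambda>k. if k = i then 1 else if k = j then - 1 else 0 :: complex"
  have "(\<Sum>k\<le>n. ?c k *\<^sub>C x k) = (\<Sum>k\<in>{i, j}. ?c k *\<^sub>C x k)"
    using ij by (intro sum.mono_neutral_right) auto
  also have "\<dots> = 0"
    using ij by (simp add: scaleC_one)
  finally show ?thesis
    using ij(1) by (intro that[of ?c]) auto
qed

text \<open>The \<open>n + 1\<close> vectors \<open>(R ^^ i) x\<close> with \<open>i \<le> n\<close>
  lie in \<open>M\<close>; the coefficients of a nontrivial relation between them form a nonzero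
  polynomial in \<open>R\<close> that kills \<open>x\<close>.\<close>

lemma power_relation_imp_nilpotent:
  fixes R :: "'a :: complex_hilbert_space \<Rightarrow> 'a"
  assumes add: "\<And>x y. R (x + y) = R x + R y"
    and scale: "\<And>c x. R (c *\<^sub>C x) = c *\<^sub>C R x"
    and no_eigenvalue: "\<And>c x. c \<noteq> 0 \<Longrightarrow> R x = c *\<^sub>C x \<Longrightarrow> x = 0"
    and M: "cdim M = n" "n > 0" "invariant_under R M" "x \<in> M"
  shows "(R ^^ n) x = 0"
proof -
  have "(R ^^ i) x \<in> M" for i
    using M(3,4) by (induction i) (auto simp: invariant_under_def)
  then obtain c where c: "\<exists>i\<le>n. c i \<noteq> 0" "(\<Sum>i\<le>n. c i *\<^sub>C (R ^^ i) x) = 0"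
    by (rule finite_dim_linear_relation[OF M(1,2), of "\<lambda>i. (R ^^ i) x"])
  define p where "p = (\<Sum>i\<le>n. monom (c i) i)"
  have coeff_p: "coeff p i = (if i \<le> n then c i else 0)" for i
    by (auto simp: p_def coeff_sum)
  show ?thesis
  proof (rule polynomial_relation_imp_nilpotent[OF add scale no_eigenvalue])
    show "p \<noteq> 0"
    proof
      assume "p = 0"
      then have "c i = 0" if "i \<le> n" for i
        using coeff_p[of i] that by simp
      then show False
        using c(1) by blast
    qed
    show "degree p \<le> n"
      by (rule degree_le) (simp add: coeff_p)
    show "(\<Sum>i\<le>n. coeff p i *\<^sub>C (R ^^ i) x) = 0"
      using c(2) by (simp add: coeff_p)
  qed
qed

section \<open>The adjoint of a weighted shift\<close>

locale weighted_shift =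
  fixes e :: "nat \<Rightarrow> 'a :: complex_hilbert_space" and w :: "nat \<Rightarrow> real" and T :: "'a \<Rightarrow> 'a"
  assumes basis: "orthonormal_basis e" and shift: "forward_weighted_shift e w T"
begin

abbreviation S where "S \<equiv> cadjoint T"

lemma w_pos: "w n > 0"
  using shift by (simp add: forward_weighted_shift_def)

lemma adjoint: "cinner (T x) y = cinner x (S y)"
  using shift by (intro cinner_cadjoint[OF basis]) (simp add: forward_weighted_shift_def)

lemma adjoint_add: "S (x + y) = S x + S y"
  by (rule cinner_left_cong_imp_eq) (simp add: adjoint[symmetric] cinner_add_right)

lemma adjoint_scaleC: "S (c *\<^sub>C x) = c *\<^sub>C S x"
  by (rule cinner_left_cong_imp_eq) (simp add: adjoint[symmetric] cinner_scaleC_right)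

lemma coeff_adjoint: "cinner (S f) (e m) = complex_of_real (w m) * cinner f (e (Suc m))"
proof -
  have "cinner (e m) (S f) = complex_of_real (w m) * cinner (e (Suc m)) f"
    using shift by (simp add: adjoint[symmetric] forward_weighted_shift_def cinner_scaleC_left)
  then have "cnj (cinner (e m) (S f)) = complex_of_real (w m) * cnj (cinner (e (Suc m)) f)"
    by simp
  then show ?thesis
    by (simp add: cinner_commute[symmetric])
qed

text \<open>The constant is a product of \<open>k\<close> positive weights. Only its being nonzero
  matters: \<open>S ^^ k\<close> moves the set of nonzero coordinates down by
  \<open>k\<close>.\<close>

lemma coeff_adjoint_power:
  "\<exists>c\<noteq>0. \<forall>f. cinner ((S ^^ k) f) (e m) = c * cinner f (e (m + k))"
proof (induction k arbitrary: m)
  case 0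
  show ?case
    by (intro exI[of _ 1]) simp
next
  case (Suc k)
  obtain c where "c \<noteq> 0" "\<forall>f. cinner ((S ^^ k) f) (e (Suc m)) = c * cinner f (e (Suc m + k))"
    using Suc.IH by blast
  then show ?case
    using w_pos[of m] by (intro exI[of _ "complex_of_real (w m) * c"]) (auto simp: coeff_adjoint)
qed

lemma coeff_adjoint_power_eq_0_iff:
  "cinner ((S ^^ k) f) (e m) = 0 \<longleftrightarrow> cinner f (e (m + k)) = 0"
  using coeff_adjoint_power[of k m] by auto

lemma adjoint_e_0: "S (e 0) = 0"
  by (rule orthonormal_basis_eqI[OF basis])
     (simp add: coeff_adjoint orthonormal_basisD[OF basis])

lemma e_nonzero: "e n \<noteq> 0"
  using orthonormal_basisD[OF basis, of n n] by auto

text \<open>\<open>cinner (T x) f = cinner x (S f)\<close> is a multiple of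
  \<open>cinner x f\<close>. This turns eigenvectors of \<open>S\<close> into invariant subspaces of
  \<open>T\<close>, to which unicellularity applies.\<close>

lemma orthogonal_adjoint_eigenvector:
  assumes "S f = c *\<^sub>C f"
  shows "closed_csubspace {x. cinner x f = 0}" "invariant_under T {x. cinner x f = 0}"
proof -
  show "invariant_under T {x. cinner x f = 0}"
    by (auto simp: invariant_under_def adjoint assms cinner_scaleC_right)
  have "closed {x. cinner x f = 0}"
    by (intro closed_Collect_eq continuous_on_const
        bounded_linear.continuous_on[OF bounded_linear_cinner_left] continuous_on_id)
  then show "closed_csubspace {x. cinner x f = 0}"
    by (auto simp: closed_csubspace_def complex_vector.subspace_def
        cinner_add_left cinner_scaleC_left)
qed

text \<open>
  An eigenvector of \<open>S\<close> yields a closed \<open>T\<close>-invariant hyperplane; two comparable hyperplanes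
  coincide, so every eigenvector is a multiple of \<open>e 0\<close>.
\<close>

lemma unicellular_adjoint_no_eigenvalue:
  assumes "unicellular T" "c \<noteq> 0" and eig: "S f = c *\<^sub>C f"
  shows "f = 0"
proof (rule ccontr)
  assume "f \<noteq> 0"
  have parallel: "\<exists>a. y = a *\<^sub>C x"
    if "{u. cinner u x = 0} \<subseteq> {u. cinner u y = 0}" "x \<noteq> 0" for x y :: 'a
  proof -
    \<comment> \<open>\<open>u\<close> is the component of \<open>y\<close> orthogonal to
      \<open>x\<close>; by the inclusion it is also orthogonal to \<open>y\<close>, hence to
      itself.\<close>
    define a where "a = cinner y x / cinner x x"
    define u where "u = y - a *\<^sub>C x"
    have "cinner u x = 0"
      using \<open>x \<noteq> 0\<close> by (simp add: u_def a_def cinner_diff_left cinner_scaleC_left)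
    moreover from this have "cinner u y = 0"
      using that(1) by blast
    ultimately have "cinner u u = 0"
      by (subst (2) u_def) (simp add: cinner_diff_right cinner_scaleC_right)
    then show ?thesis
      by (auto simp: u_def)
  qed
  \<comment> \<open>The comparison partner for \<open>f\<close> is \<open>e 0\<close>, an
    eigenvector for the eigenvalue 0.\<close>
  have "S (e 0) = 0 *\<^sub>C e 0"
    by (simp add: adjoint_e_0)
  then have "{u. cinner u f = 0} \<subseteq> {u. cinner u (e 0) = 0} \<or>
      {u. cinner u (e 0) = 0} \<subseteq> {u. cinner u f = 0}"
    using assms(1) orthogonal_adjoint_eigenvector[OF eig]
      orthogonal_adjoint_eigenvector[of "e 0" 0]
    unfolding unicellular_def by blast
  then consider a where "e 0 = a *\<^sub>C f" | a where "f = a *\<^sub>C e 0"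
    using parallel \<open>f \<noteq> 0\<close> e_nonzero by blast
  then have "S f = 0"
  proof cases
    case 1
    then have "a \<noteq> 0" "a *\<^sub>C S f = 0"
      using e_nonzero[of 0] adjoint_e_0 adjoint_scaleC[of a f] by auto
    then show ?thesis
      by (simp add: complex_vector.scale_eq_0_iff)
  next
    case 2
    then show ?thesis
      by (simp add: adjoint_scaleC adjoint_e_0)
  qed
  then show False
    using eig \<open>c \<noteq> 0\<close> \<open>f \<noteq> 0\<close> by (simp add: complex_vector.scale_eq_0_iff)
qed

text \<open>With \<open>r\<close> a square root of \<open>c\<close>, the operator
  \<open>S^2 - c\<close> factors as \<open>(S - r)(S + r)\<close>, and both factors are
  injective.\<close>

lemma unicellular_adjoint_square_no_eigenvalue:
  assumes "unicellular T" "c \<noteq> 0" "(S ^^ 2) f = c *\<^sub>C f"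
  shows "f = 0"
proof -
  define r where "r = csqrt c"
  have r: "r * r = c" "r \<noteq> 0"
    using \<open>c \<noteq> 0\<close> power2_csqrt[of c] by (auto simp: r_def power2_eq_square)
  have "S (S f + r *\<^sub>C f) = r *\<^sub>C (S f + r *\<^sub>C f)"
    using assms(3)
    by (simp add: numeral_2_eq_2 adjoint_add adjoint_scaleC scaleC_add_right scaleC_scaleC r)
  then have "S f + r *\<^sub>C f = 0"
    using unicellular_adjoint_no_eigenvalue[OF assms(1) r(2)] by blast
  then have "S f = (- r) *\<^sub>C f"
    by (simp add: eq_neg_iff_add_eq_0)
  then show ?thesis
    using unicellular_adjoint_no_eigenvalue[OF assms(1), of "- r"] r(2) by simp
qed

text \<open>Every \<open>k \<ge> 2\<close> arises from 2 or 3 by adding 2 repeatedly.\<close>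

lemma invariant_adjoint_power:
  assumes "invariant_under (S ^^ 2) M" "invariant_under (S ^^ 3) M" "k \<ge> 2" "f \<in> M"
  shows "(S ^^ k) f \<in> M"
  using \<open>k \<ge> 2\<close>
proof (induction k rule: less_induct)
  case (less k)
  show ?case
  proof (cases "k \<le> 3")
    case True
    with less.prems have "k = 2 \<or> k = 3"
      by auto
    then show ?thesis
      using assms by (auto simp: invariant_under_def)
  next
    case False
    then have "(S ^^ (k - 2)) f \<in> M"
      by (intro less.IH) auto
    then have "(S ^^ 2) ((S ^^ (k - 2)) f) \<in> M"
      using assms(1) by (auto simp: invariant_under_def)
    then have "(S ^^ (2 + (k - 2))) f \<in> M"
      by (simp only: funpow_add comp_apply)
    then show ?thesis
      using less.prems by (simp only: le_add_diff_inverse)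
  qed
qed

section \<open>Linear independence and spans of basis vectors\<close>

lemma basis_independent: "\<not> cdependent (e ` I)"
proof
  assume "cdependent (e ` I)"
  then obtain t u v where t: "finite t" "t \<subseteq> e ` I" "(\<Sum>v\<in>t. u v *\<^sub>C v) = 0" "v \<in> t" "u v \<noteq> 0"
    by (auto simp: complex_vector.dependent_explicit)
  have ortho: "cinner x v = (if x = v then 1 else 0)" if x: "x \<in> t" for x
  proof -
    obtain i j where "x = e i" "v = e j"
      using x t(2,4) by blast
    then show ?thesis
      using orthonormal_basisD[OF basis, of i i] orthonormal_basisD[OF basis, of i j] by auto
  qed
  have "0 = cinner (\<Sum>x\<in>t. u x *\<^sub>C x) v"
    by (simp add: t(3))
  also have "\<dots> = (\<Sum>x\<in>t. if x = v then u x else 0)"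
    unfolding cinner_sum_left cinner_scaleC_left using ortho by (intro sum.cong) auto
  also have "\<dots> = u v"
    using t(1,4) by simp
  finally show False
    using t(5) by simp
qed

lemma inj_basis: "inj e"
proof (rule injI)
  fix m n assume "e m = e n"
  then have "cinner (e m) (e n) = 1"
    using orthonormal_basisD[OF basis, of n n] by simp
  then show "m = n"
    by (simp add: orthonormal_basisD[OF basis] split: if_splits)
qed

lemma in_span_basisI:
  assumes "\<And>m. m \<ge> k \<Longrightarrow> cinner f (e m) = 0" "{..<k} \<subseteq> I"
  shows "f \<in> cspan (e ` I)"
proof -
  have "(\<Sum>i<k. cinner f (e i) *\<^sub>C e i) \<in> cspan (e ` I)"
    using assms(2)
    by (intro complex_vector.span_sum complex_vector.span_scale complex_vector.span_base) auto
  then show ?thesis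
    using orthonormal_basis_finite_expansion[OF basis, of k f] assms(1) by simp
qed

lemma coeff_span_eq_0:
  assumes "f \<in> cspan (e ` I)" "m \<notin> I"
  shows "cinner f (e m) = 0"
  using assms(1)
proof (induction rule: complex_vector.span_induct)
  case base
  show ?case
    by (auto simp: complex_vector.subspace_def cinner_add_left cinner_scaleC_left)
next
  case (step x)
  then show ?case
    using assms(2) orthonormal_basisD[OF basis] by auto
qed

end

section \<open>Determination of \<open>M\<close> from its top index\<close>

theorem theorem2p11:
  fixes e :: "nat \<Rightarrow> 'a :: complex_hilbert_space"
    and w :: "nat \<Rightarrow> real"
    and T :: "'a \<Rightarrow> 'a"
    and n :: nat
    and M :: "'a set"
  assumes "orthonormal_basis e"
    and "forward_weighted_shift e w T"
    and "unicellular T"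
    and "n \<ge> 1"
    and "closed_csubspace M"
    and "cdim M = n"
    and "invariant_under (cadjoint T ^^ 2) M"
    and "invariant_under (cadjoint T ^^ 3) M"
  shows "\<exists>\<alpha> \<beta> :: complex. (\<alpha>, \<beta>) \<noteq> (0, 0) \<and>
    M = cspan (e ` {k. k + 1 < n} \<union> {\<alpha> *\<^sub>C e (n - 1) + \<beta> *\<^sub>C e n})"
proof -
  interpret weighted_shift e w T
    using assms(1,2) by unfold_locales
  note ortho = orthonormal_basisD[OF basis]
  have sub: "csubspace M"
    using assms(5) by (simp add: closed_csubspace_def)
  \<comment> \<open>The \<open>n\<close>-th power of \<open>S ^^ 2\<close> kills \<open>M\<close>;
    coordinate \<open>m - 2 * n\<close> of \<open>(S ^^ (2 * n)) f = 0\<close> is a nonzero multiple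
    of coordinate \<open>m\<close> of \<open>f\<close>.\<close>
  have vanish: "cinner f (e m) = 0" if "f \<in> M" "m \<ge> 2 * n" for f m
  proof -
    have "((S ^^ 2) ^^ n) f = 0"
      by (rule power_relation_imp_nilpotent[where M = M])
         (use assms that in \<open>auto simp: numeral_2_eq_2 adjoint_add adjoint_scaleC
            intro: unicellular_adjoint_square_no_eigenvalue\<close>)
    then have "(S ^^ (2 * n)) f = 0"
      by (simp add: funpow_mult)
    then show ?thesis
      using coeff_adjoint_power_eq_0_iff[of "2 * n" f "m - 2 * n"] \<open>m \<ge> 2 * n\<close> by simp
  qed
  define D where "D = {m. \<exists>f\<in>M. cinner f (e m) \<noteq> 0}"
  have "D \<subseteq> {..<2 * n}"
    using vanish by (auto simp: D_def not_le[symmetric])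
  then have "finite D"
    by (rule finite_subset) simp
  \<comment> \<open>Here \<open>n \<ge> 1\<close> enters. Together with finiteness it ensures that
    \<open>Max D\<close> is attained.\<close>
  have "D \<noteq> {}"
  proof
    assume "D = {}"
    then have "f = 0" if "f \<in> M" for f
      using that by (intro orthonormal_basis_eqI[OF basis]) (auto simp: D_def)
    then have "M \<subseteq> {0}"
      by blast
    then have "cdim M \<le> card ({} :: 'a set)"
      by (intro complex_vector.dim_le_card) auto
    then show False
      using assms(4,6) by simp
  qed
  define d where "d = Max D"
  have "d \<in> D"
    using \<open>finite D\<close> \<open>D \<noteq> {}\<close> by (simp add: d_def)
  then obtain f where f: "f \<in> M" "cinner f (e d) \<noteq> 0"
    by (auto simp: D_def)
  have above: "cinner h (e m) = 0" if "h \<in> M" "m > d" for h m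
  proof (rule ccontr)
    assume "cinner h (e m) \<noteq> 0"
    with \<open>h \<in> M\<close> have "m \<in> D"
      by (auto simp: D_def)
    then show False
      using Max_ge[OF \<open>finite D\<close>] \<open>m > d\<close> by (simp add: d_def not_le[symmetric])
  qed
  \<comment> \<open>The bound on \<open>j\<close> says \<open>d - j \<ge> 2\<close>, so
    \<open>(S ^^ (d - j)) f\<close> stays in \<open>M\<close>. Its top index is \<open>j\<close>,
    and its lower terms are in \<open>M\<close> by induction, so they can be subtracted.\<close>
  have lower: "e j \<in> M" if "j + 1 < d" for j
    using that
  proof (induction j rule: less_induct)
    case (less j)
    define g where "g = (S ^^ (d - j)) f"
    have "g \<in> M"
      unfolding g_def using less.prems f(1) assms(7,8) by (intro invariant_adjoint_power) auto
    have "cinner g (e j) \<noteq> 0"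
      using less.prems f(2) by (simp add: g_def coeff_adjoint_power_eq_0_iff)
    have "g = (\<Sum>i<Suc j. cinner g (e i) *\<^sub>C e i)"
    proof (rule orthonormal_basis_finite_expansion[OF basis])
      fix m assume "Suc j \<le> m"
      then show "cinner g (e m) = 0"
        using less.prems f(1) by (simp add: g_def coeff_adjoint_power_eq_0_iff above)
    qed
    then have "cinner g (e j) *\<^sub>C e j = g - (\<Sum>i<j. cinner g (e i) *\<^sub>C e i)"
      by (simp add: algebra_simps)
    moreover have "(\<Sum>i<j. cinner g (e i) *\<^sub>C e i) \<in> M"
      using less by (intro complex_vector.subspace_sum complex_vector.subspace_scale sub) auto
    ultimately have "cinner g (e j) *\<^sub>C e j \<in> M"
      using \<open>g \<in> M\<close> sub by (simp add: complex_vector.subspace_diff)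
    then show ?case
      using \<open>cinner g (e j) \<noteq> 0\<close> csubspace_scaleC_cancel[OF sub] by blast
  qed
  have M_le: "M \<subseteq> cspan (e ` {..d})"
    by (rule subsetI, rule in_span_basisI[of "Suc d"]) (auto simp: above)
  show ?thesis
  proof (cases "M = cspan (e ` {..d})")
    case True
    then have "n = Suc d"
      using assms(6) complex_vector.dim_span_eq_card_independent[OF basis_independent[of "{..d}"]]
      by (simp add: card_image inj_on_subset[OF inj_basis])
    moreover have "e ` {k. k < d} \<union> {e d} = e ` {..d}"
      by (auto simp: le_less)
    \<comment> \<open>As \<open>n - 1 = d\<close>, the pair \<open>(1, 0)\<close> makes the last
      generator \<open>e d\<close>.\<close>
    ultimately show ?thesis
      using True by (intro exI[of _ 1] exI[of _ 0]) (simp add: scaleC_one)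
  next
    case False
    define A where "A = e ` {k. k + 1 < d}"
    have A: "cspan A \<subseteq> M"
      unfolding A_def using lower sub by (intro complex_vector.span_minimal) auto
    define \<alpha> \<beta> where "\<alpha> = cinner f (e (d - 1))" and "\<beta> = cinner f (e d)"
    \<comment> \<open>\<open>g\<close> keeps the two top coordinates of \<open>f\<close>; the rest
      of \<open>f\<close> lies in \<open>cspan A\<close>.\<close>
    define g where "g = \<alpha> *\<^sub>C e (d - 1) + \<beta> *\<^sub>C e d"
    \<comment> \<open>For \<open>d = 0\<close> the space would be all of \<open>cspan {e 0}\<close>,
      the case already treated. From here on \<open>d - 1\<close> is a genuine predecessor, distinct
      from \<open>d\<close>.\<close>
    have "d > 0"
    proof (rule ccontr)
      assume "\<not> d > 0"
      then have "f = cinner f (e 0) *\<^sub>C e 0"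
        using orthonormal_basis_finite_expansion[OF basis, of 1 f] above[OF f(1)] by simp
      then have "e 0 \<in> M"
        using f \<open>\<not> d > 0\<close> csubspace_scaleC_cancel[OF sub, of "cinner f (e 0)"] by simp
      then have "cspan (e ` {..d}) \<subseteq> M"
        using sub \<open>\<not> d > 0\<close> by (intro complex_vector.span_minimal) auto
      then show False
        using M_le False by blast
    qed
    then have coeff_g: "cinner g (e d) = \<beta>"
      by (auto simp: g_def cinner_add_left cinner_scaleC_left ortho)
    \<comment> \<open>Modulo \<open>cspan A\<close>, a vector of \<open>M\<close> is determined by
      its coordinates at \<open>d - 1\<close> and \<open>d\<close>.\<close>
    have top_part: "h - (cinner h (e (d - 1)) *\<^sub>C e (d - 1) + cinner h (e d) *\<^sub>C e d) \<in> cspan A"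
      if "h \<in> M" for h
      unfolding A_def
    proof (rule in_span_basisI[of "d - 1"])
      fix m assume "d - 1 \<le> m"
      then consider "m = d - 1" | "m = d" | "m > d"
        by linarith
      then show "cinner (h - (cinner h (e (d - 1)) *\<^sub>C e (d - 1) + cinner h (e d) *\<^sub>C e d)) (e m) = 0"
        using \<open>d > 0\<close> above[OF that]
        by cases (auto simp: cinner_diff_left cinner_add_left cinner_scaleC_left ortho)
    qed auto
    have "g \<in> M"
    proof -
      have "f - g \<in> M"
        using top_part[OF f(1)] A unfolding g_def \<alpha>_def \<beta>_def by (rule subsetD[rotated])
      then have "f - (f - g) \<in> M"
        by (rule complex_vector.subspace_diff[OF sub f(1)])
      then show ?thesis
        by simp
    qed
    \<comment> \<open>Otherwise \<open>g\<close> and \<open>\<beta> \<noteq> 0\<close> would put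
      \<open>e d\<close> into \<open>M\<close> as well, and \<open>M\<close> would be the full
      span.\<close>
    have e_notin: "e (d - 1) \<notin> M"
    proof
      assume e1: "e (d - 1) \<in> M"
      then have "g - \<alpha> *\<^sub>C e (d - 1) \<in> M"
        using \<open>g \<in> M\<close> sub by (intro complex_vector.subspace_diff complex_vector.subspace_scale)
      then have "\<beta> *\<^sub>C e d \<in> M"
        by (simp add: g_def)
      then have "e d \<in> M"
        using f(2) csubspace_scaleC_cancel[OF sub] unfolding \<beta>_def by blast
      have "e k \<in> M" if k: "k \<le> d" for k
      proof -
        consider "k + 1 < d" | "k = d - 1" | "k = d"
          using k by linarith
        then show ?thesis
          using lower e1 \<open>e d \<in> M\<close> by cases auto
      qed
      then have "cspan (e ` {..d}) \<subseteq> M"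
        using sub by (intro complex_vector.span_minimal) auto
      then show False
        using M_le False by blast
    qed
    have "M \<subseteq> cspan (insert g A)"
    proof
      fix h assume h: "h \<in> M"
      \<comment> \<open>\<open>b\<close> is chosen so that \<open>u\<close> has no coordinate at
        \<open>d\<close>. Modulo \<open>cspan A\<close>, \<open>u\<close> is then a multiple of
        \<open>e (d - 1)\<close> lying in \<open>M\<close>, and by \<open>e_notin\<close> that
        multiple is zero.\<close>
      define b where "b = cinner h (e d) / \<beta>"
      define u where "u = h - b *\<^sub>C g"
      have "u \<in> M"
        unfolding u_def using h \<open>g \<in> M\<close> sub
        by (intro complex_vector.subspace_diff complex_vector.subspace_scale)
      have "cinner u (e d) = 0"
        using coeff_g f(2) by (simp add: u_def b_def \<beta>_def cinner_diff_left cinner_scaleC_left)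
      then have *: "u - cinner u (e (d - 1)) *\<^sub>C e (d - 1) \<in> cspan A"
        using top_part[OF \<open>u \<in> M\<close>] by simp
      then have "u - (u - cinner u (e (d - 1)) *\<^sub>C e (d - 1)) \<in> M"
        using A by (blast intro: complex_vector.subspace_diff[OF sub \<open>u \<in> M\<close>])
      then have "cinner u (e (d - 1)) *\<^sub>C e (d - 1) \<in> M"
        by simp
      then have "cinner u (e (d - 1)) = 0"
        using e_notin csubspace_scaleC_cancel[OF sub] by blast
      then have "u \<in> cspan (insert g A)"
        using * complex_vector.span_mono[of A "insert g A"] by auto
      moreover have "b *\<^sub>C g \<in> cspan (insert g A)"
        by (intro complex_vector.span_scale complex_vector.span_base) simp
      ultimately have "u + b *\<^sub>C g \<in> cspan (insert g A)"
        by (rule complex_vector.span_add)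
      then show "h \<in> cspan (insert g A)"
        by (simp add: u_def)
    qed
    moreover have "cspan (insert g A) \<subseteq> M"
      using \<open>g \<in> M\<close> A sub complex_vector.span_superset[of A]
      by (intro complex_vector.span_minimal) auto
    ultimately have M_eq: "M = cspan (insert g A)"
      by blast
    \<comment> \<open>Dimension count: \<open>A\<close> consists of \<open>d - 1\<close> independent
      vectors without coordinate at \<open>d\<close>, and \<open>g\<close> adds one more, so
      \<open>n = d\<close>.\<close>
    have "cinner g (e d) \<noteq> 0"
      using coeff_g f(2) by (simp add: \<beta>_def)
    then have g_notin: "g \<notin> cspan A"
      unfolding A_def using coeff_span_eq_0 by force
    then have "\<not> cdependent (insert g A)"
      unfolding A_def by (intro complex_vector.independent_insertI basis_independent)
    then have "n = card (insert g A)"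
      using assms(6) complex_vector.dim_span_eq_card_independent M_eq by metis
    also have "\<dots> = Suc (card {..<d - 1})"
    proof -
      have "A = e ` {..<d - 1}"
        by (auto simp: A_def)
      moreover have "g \<notin> A"
        using g_notin complex_vector.span_base by blast
      ultimately show ?thesis
        by (simp add: card_image inj_on_subset[OF inj_basis])
    qed
    finally have "n = d"
      using \<open>d > 0\<close> by simp
    \<comment> \<open>With \<open>n = d\<close> the indices agree with the claim, and
      \<open>\<beta> \<noteq> 0\<close> makes the pair nonzero.\<close>
    then show ?thesis
      using M_eq f(2)
      by (intro exI[of _ \<alpha>] exI[of _ \<beta>]) (auto simp: A_def g_def \<beta>_def)
  qed
qed

end
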